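(* Let $\mathcal{U}$ be a finite Ulam set in $\mathbb{Z} \times (\mathbb{Z}/n\mathbb{Z})$ and let $x_{\max}$ be the greatest $x$-coordinate of elements of $\mathcal{U}$. Then $\mathcal{U}$ contains at least $5$ elements of the form $(x_{\max},y)$.
   Context: Here $n$ is a positive integer. An Ulam set in $\mathbb{Z}\times(\mathbb{Z}/n\mathbb{Z})$ is a set $\mathcal{U}(S)$ obtained from a finite initial set $S\subset \mathbb{Z}\times(\mathbb{Z}/n\mathbb{Z})$ all of whose elements have strictly positive first coordinate ($x$-coordinate), as follows. The size of $(x,y)$ is $x$. First put the elements of $S$ into $\mathcal{U}(S)$; then repeatedly add a smallest (in size) element not already in $\mathcal{U}(S)$ that is uniquely represented as the sum of two distinct elements already in $\mathcal{U}(S)$ (with $p+q$ and $q+p$ considered the same representation). Ties in size may be broken arbitrarily without affecting the resulting set.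
   Formalization: The formal theorem also assumes that the Ulam set has at least 2 elements: if the initial set is a single element, the Ulam set is that singleton and has only one element with x-coordinate x_max, and for an empty initial set x_max does not exist. *)

theory Defs
  imports "HOL-Algebra.Elementary_Groups"
begin

text \<open>
  The residue class group is the library's \<open>integer_mod_group n\<close>, whose carrier for \<open>n > 0\<close> is the
  set of representatives \<open>{0..<n}\<close>. The size of an element is its first coordinate \<open>fst\<close>.
\<close>

abbreviation Z_times_Zmod :: "nat \<Rightarrow> (int \<times> int) monoid" where
  "Z_times_Zmod n \<equiv> integer_group \<times>\<times> integer_mod_group n"

text \<open>A representation is an unordered pair, so that \<open>p + q\<close> and \<open>q + p\<close> are counted once.\<close>

definition uniquely_represented :: "nat \<Rightarrow> (int \<times> int) set \<Rightarrow> int \<times> int \<Rightarrow> bool" where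
  "uniquely_represented n A p \<longleftrightarrow>
     (\<exists>!P. \<exists>q\<in>A. \<exists>r\<in>A. q \<noteq> r \<and> P = {q, r} \<and> q \<otimes>\<^bsub>Z_times_Zmod n\<^esub> r = p)"

definition ulam_candidates :: "nat \<Rightarrow> (int \<times> int) set \<Rightarrow> (int \<times> int) set" where
  "ulam_candidates n A =
     {p \<in> carrier (Z_times_Zmod n). p \<notin> A \<and> uniquely_represented n A p}"

text \<open>
  A step adds one candidate of least size, with any choice among ties; if there is no candidate,
  the process has stopped and the set stays as it is.
\<close>

definition ulam_step :: "nat \<Rightarrow> (int \<times> int) set \<Rightarrow> (int \<times> int) set \<Rightarrow> bool" where
  "ulam_step n A B \<longleftrightarrow>
     (if ulam_candidates n A = {} then B = A
      else \<exists>p. is_arg_min fst (\<lambda>q. q \<in> ulam_candidates n A) p \<and> B = insert p A)"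

text \<open>
  \<open>U\<close> is obtained from \<open>S\<close> by some run of the process. This is a relation rather than a function of
  \<open>S\<close>, so that no particular way of breaking ties is fixed.
\<close>

definition ulam_generated :: "nat \<Rightarrow> (int \<times> int) set \<Rightarrow> (int \<times> int) set \<Rightarrow> bool" where
  "ulam_generated n S U \<longleftrightarrow>
     (\<exists>A. A 0 = S \<and> (\<forall>k. ulam_step n (A k) (A (Suc k))) \<and> U = (\<Union>k. A k))"

definition ulam_set :: "nat \<Rightarrow> (int \<times> int) set \<Rightarrow> bool" where
  "ulam_set n U \<longleftrightarrow>
     (\<exists>S. finite S \<and> S \<subseteq> carrier (Z_times_Zmod n) \<and> (\<forall>p\<in>S. 0 < fst p) \<and> ulam_generated n S U)"

text \<open>
  With a single initial element there is no sum of two distinct elements, so every such singleton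
  is a finite Ulam set. Results on the elements of greatest size have to exclude this case.
\<close>

lemma ulam_set_singleton:
  assumes "p \<in> carrier (Z_times_Zmod n)" "0 < fst p"
  shows "ulam_set n {p}"
proof -
  have "ulam_candidates n {p} = {}"
    by (auto simp: ulam_candidates_def uniquely_represented_def)
  then have "ulam_generated n {p} {p}"
    unfolding ulam_generated_def ulam_step_def by (intro exI[of _ "\<lambda>_. {p}"]) simp
  then show ?thesis
    unfolding ulam_set_def using assms by (intro exI[of _ "{p}"]) simp
qed

end

theory Submission
  imports Defs
begin

text \<open>
  A finite Ulam set \<open>U\<close> arises when the process runs out of candidates. All sizes in \<open>U\<close> are
  positive, so a sum of two distinct elements that exceeds the top size \<open>m\<close> lies outside \<open>U\<close>, and
  since it is not a candidate it must have a second representation (\<open>second_representation\<close>). This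
  is applied to the top row \<open>T\<close>, the set of elements of size \<open>m\<close>.

  If \<open>T = {t}\<close>, let \<open>s\<close> be an element of second largest size: the size of \<open>t + s\<close> forces \<open>t\<close> to be
  a summand, hence the representation is unique, a contradiction. So \<open>T\<close> has two distinct
  elements. A sum of two elements of \<open>T\<close> has size \<open>2m\<close>, so its second representation lies in \<open>T\<close>
  as well, and by cancellation it is disjoint from the first. Hence \<open>T\<close> has at least four
  elements. If it had exactly four, then each of the three ways to split it into two pairs would
  give pairs with equal sums. Subtracting these equations shows that the differences of elements
  of \<open>T\<close> are killed by \<open>2\<close>. But \<open>\<int>/n\<close> has at most one nonzero element of order \<open>2\<close>
  (\<open>residues_at_half_distance_eq\<close>), so \<open>T\<close> would have at most two elements.
\<close>

section \<open>Finite Ulam sets\<close>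

lemma mult_Z_times_Zmod:
  "q \<otimes>\<^bsub>Z_times_Zmod n\<^esub> r = (fst q + fst r, (snd q + snd r) mod int n)"
  by (cases q; cases r) (simp add: integer_mod_group_def)

lemma uniquely_representedE:
  assumes "uniquely_represented n A p"
  obtains q r where "q \<in> A" "r \<in> A" "q \<noteq> r" "q \<otimes>\<^bsub>Z_times_Zmod n\<^esub> r = p"
  using assms unfolding uniquely_represented_def by blast

lemma ulam_step_cases:
  assumes "ulam_step n A B"
  obtains (stop) "ulam_candidates n A = {}" "B = A"
  | (add) p where "p \<in> ulam_candidates n A" "B = insert p A"
  using assms unfolding ulam_step_def is_arg_min_def by (auto split: if_splits)

lemma ulam_set_carrier_pos:
  assumes "ulam_set n U" "p \<in> U"
  shows "p \<in> carrier (Z_times_Zmod n)" "0 < fst p"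
proof -
  obtain S A where S: "S \<subseteq> carrier (Z_times_Zmod n)" "\<forall>p\<in>S. 0 < fst p"
    and A: "A 0 = S" "\<And>k. ulam_step n (A k) (A (Suc k))" "U = (\<Union>k. A k)"
    using assms(1) unfolding ulam_set_def ulam_generated_def by blast
  have "\<forall>p\<in>A k. p \<in> carrier (Z_times_Zmod n) \<and> 0 < fst p" for k
  proof (induction k)
    case 0
    then show ?case using S A(1) by blast
  next
    case (Suc k)
    from A(2)[of k] show ?case
    proof (cases rule: ulam_step_cases)
      case stop
      then show ?thesis using Suc by simp
    next
      case (add p)
      then have p: "p \<in> carrier (Z_times_Zmod n)" "uniquely_represented n (A k) p"
        unfolding ulam_candidates_def by auto
      from p(2) obtain q r where "q \<in> A k" "r \<in> A k" "q \<otimes>\<^bsub>Z_times_Zmod n\<^esub> r = p"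
        by (rule uniquely_representedE)
      then have "0 < fst p"
        using Suc by (auto simp: mult_Z_times_Zmod intro!: add_pos_pos)
      with p(1) add(2) Suc show ?thesis by simp
    qed
  qed
  with assms(2) A(3) show "p \<in> carrier (Z_times_Zmod n)" "0 < fst p" by blast+
qed

text \<open>
  The stages of the process increase to \<open>U\<close>. A finite \<open>U\<close> is therefore itself a stage, and a
  candidate for it would be added in the next step without belonging to \<open>U\<close>.
\<close>

lemma finite_ulam_set_no_candidates:
  assumes "ulam_set n U" "finite U"
  shows "ulam_candidates n U = {}"
proof -
  obtain A where A: "\<And>k. ulam_step n (A k) (A (Suc k))" "U = (\<Union>k. A k)"
    using assms(1) unfolding ulam_set_def ulam_generated_def by blast
  have "A k \<subseteq> A (Suc k)" for k
    using A(1)[of k] by (cases rule: ulam_step_cases) auto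
  then have mono: "A i \<subseteq> A j" if "i \<le> j" for i j
    using that by (rule lift_Suc_mono_le)
  have "\<forall>p\<in>U. \<exists>k. p \<in> A k" using A(2) by blast
  then obtain K where K: "\<And>p. p \<in> U \<Longrightarrow> p \<in> A (K p)" by metis
  define N where "N = Max (insert 0 (K ` U))"
  have "K p \<le> N" if "p \<in> U" for p
    unfolding N_def using that assms(2) by simp
  then have "U \<subseteq> A N" using K mono by blast
  then have N: "A N = U" "A (Suc N) \<subseteq> U" using A(2) by auto
  from A(1)[of N] show ?thesis
  proof (cases rule: ulam_step_cases)
    case stop
    then show ?thesis using N by simp
  next
    case (add p)
    then show ?thesis using N unfolding ulam_candidates_def by auto
  qed
qed

lemma second_representation:
  assumes "0 < n" "ulam_set n U" "finite U"
    and qr: "q \<in> U" "r \<in> U" "q \<noteq> r"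
    and large: "Max (fst ` U) < fst q + fst r"
  obtains q' r' where "q' \<in> U" "r' \<in> U" "q' \<noteq> r'" "{q', r'} \<noteq> {q, r}"
    "q' \<otimes>\<^bsub>Z_times_Zmod n\<^esub> r' = q \<otimes>\<^bsub>Z_times_Zmod n\<^esub> r"
proof -
  define p where "p = q \<otimes>\<^bsub>Z_times_Zmod n\<^esub> r"
  have "p \<notin> U"
  proof
    assume "p \<in> U"
    then have "fst p \<le> Max (fst ` U)" using assms(3) by simp
    with large show False by (simp add: p_def mult_Z_times_Zmod)
  qed
  moreover have "p \<in> carrier (Z_times_Zmod n)"
    using assms(1) by (auto simp: p_def mult_Z_times_Zmod carrier_integer_mod_group)
  ultimately have "\<not> uniquely_represented n U p"
    using finite_ulam_set_no_candidates[OF assms(2,3)] unfolding ulam_candidates_def by blast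
  then have "\<exists>q'\<in>U. \<exists>r'\<in>U. q' \<noteq> r' \<and> {q', r'} \<noteq> {q, r} \<and> q' \<otimes>\<^bsub>Z_times_Zmod n\<^esub> r' = p"
    using qr p_def unfolding uniquely_represented_def by blast
  then show thesis using that p_def by blast
qed

section \<open>Sums of two distinct residues\<close>

lemma mod_add_left_cancel:
  fixes n x y y' :: int
  assumes "(x + y) mod n = (x + y') mod n" "y \<in> {0..<n}" "y' \<in> {0..<n}"
  shows "y = y'"
proof -
  have "y mod n = y' mod n"
    using mod_diff_cong[OF assms(1) refl[of "x mod n"]] by simp
  with assms(2,3) show ?thesis by simp
qed

text \<open>
  Distinct representatives are less than \<open>n\<close> apart, so twice their difference can only be \<open>n\<close> or
  \<open>- n\<close>. If \<open>b\<close> has two such partners on the same side, they coincide; if they were on opposite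
  sides, they would be \<open>n\<close> apart.
\<close>

lemma residues_at_half_distance_eq:
  fixes n b c d :: int
  assumes "b \<in> {0..<n}" "c \<in> {0..<n}" "d \<in> {0..<n}" "b \<noteq> c" "b \<noteq> d"
    and "n dvd 2 * (b - c)" "n dvd 2 * (b - d)"
  shows "c = d"
proof -
  have half: "2 * (b - x) = n \<or> 2 * (b - x) = - n"
    if x: "x \<in> {0..<n}" "b \<noteq> x" "n dvd 2 * (b - x)" for x
  proof -
    from x(3) obtain k where k: "2 * (b - x) = n * k" by (auto simp: dvd_def)
    have "\<bar>n * k\<bar> < n * 2" "0 < n" using x(1) assms(1) by (auto simp flip: k)
    then have "\<bar>k\<bar> < 2" by (simp add: abs_mult)
    moreover have "k \<noteq> 0" using k x(2) by auto
    ultimately have "k = 1 \<or> k = - 1" by linarith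
    with k show ?thesis by auto
  qed
  show ?thesis
    using half[of c] half[of d] assms by auto
qed

lemma four_residues_with_equal_pair_sums:
  fixes n a b c d :: int
  assumes "b \<in> {0..<n}" "c \<in> {0..<n}" "d \<in> {0..<n}" "b \<noteq> c" "b \<noteq> d"
    and ab: "(a + b) mod n = (c + d) mod n"
    and ac: "(a + c) mod n = (b + d) mod n"
    and ad: "(a + d) mod n = (b + c) mod n"
  shows "c = d"
proof (rule residues_at_half_distance_eq)
  have "n dvd (a + b - (c + d)) - (a + c - (b + d))"
    using ab ac unfolding mod_eq_dvd_iff by (rule dvd_diff)
  then show "n dvd 2 * (b - c)" by (simp add: algebra_simps)
  have "n dvd (a + b - (c + d)) - (a + d - (b + c))"
    using ab ad unfolding mod_eq_dvd_iff by (rule dvd_diff)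
  then show "n dvd 2 * (b - d)" by (simp add: algebra_simps)
qed (use assms in auto)

text \<open>
  The hypothesis yields a second pair disjoint from \<open>{x, y}\<close>, so four elements at least. With
  exactly four, that second pair is always the complement of \<open>{x, y}\<close>, which determines all
  coincidences among the pair sums.
\<close>

lemma card_ge_5_if_no_unique_pair_sum:
  fixes n :: int and T :: "int set"
  assumes T: "finite T" "T \<subseteq> {0..<n}" "2 \<le> card T"
    and second: "\<And>x y. x \<in> T \<Longrightarrow> y \<in> T \<Longrightarrow> x \<noteq> y \<Longrightarrow>
      \<exists>x'\<in>T. \<exists>y'\<in>T. x' \<noteq> y' \<and> {x', y'} \<noteq> {x, y} \<and> (x' + y') mod n = (x + y) mod n"
  shows "5 \<le> card T"
proof -
  have disjoint: "\<exists>x'\<in>T - {x, y}. \<exists>y'\<in>T - {x, y}. x' \<noteq> y' \<and> (x + y) mod n = (x' + y') mod n"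
    if xy: "x \<in> T" "y \<in> T" "x \<noteq> y" for x y
  proof -
    obtain x' y' where *: "x' \<in> T" "y' \<in> T" "x' \<noteq> y'" "{x', y'} \<noteq> {x, y}"
      "(x' + y') mod n = (x + y) mod n"
      using second[OF xy] by blast
    have cancel: "v = w" if "(u + v) mod n = (u + w) mod n" "v \<in> T" "w \<in> T" for u v w
      using mod_add_left_cancel[OF that(1)] that(2,3) T(2) by blast
    have "x' \<noteq> x" using cancel[of x y' y] * xy by auto
    moreover have "x' \<noteq> y" using cancel[of y y' x] * xy by (auto simp: add.commute)
    moreover have "y' \<noteq> x" using cancel[of x x' y] * xy by (auto simp: add.commute)
    moreover have "y' \<noteq> y" using cancel[of y x' x] * xy by (auto simp: add.commute)
    ultimately show ?thesis using * by fastforce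
  qed
  obtain a b where ab: "a \<in> T" "b \<in> T" "a \<noteq> b"
    using T(1,3) card_le_Suc0_iff_eq[OF T(1)] by force
  obtain c d where cd: "c \<in> T - {a, b}" "d \<in> T - {a, b}" "c \<noteq> d"
    "(a + b) mod n = (c + d) mod n"
    using disjoint[OF ab] by blast
  have four: "{a, b, c, d} \<subseteq> T" "card {a, b, c, d} = 4" using ab cd by auto
  show ?thesis
  proof (rule ccontr)
    assume "\<not> 5 \<le> card T"
    then have eq: "{a, b, c, d} = T"
      using four T(1) by (intro card_seteq) auto
    have "(a + c) mod n = (b + d) mod n"
    proof -
      have rest: "T - {a, c} = {b, d}" unfolding eq[symmetric] using ab cd by auto
      have "\<exists>x\<in>{b, d}. \<exists>y\<in>{b, d}. x \<noteq> y \<and> (a + c) mod n = (x + y) mod n"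
        unfolding rest[symmetric] by (rule disjoint) (use ab cd in blast)+
      then show ?thesis by (auto simp: add.commute[of d b])
    qed
    moreover have "(a + d) mod n = (b + c) mod n"
    proof -
      have rest: "T - {a, d} = {b, c}" unfolding eq[symmetric] using ab cd by auto
      have "\<exists>x\<in>{b, c}. \<exists>y\<in>{b, c}. x \<noteq> y \<and> (a + d) mod n = (x + y) mod n"
        unfolding rest[symmetric] by (rule disjoint) (use ab cd in blast)+
      then show ?thesis by (auto simp: add.commute[of c b])
    qed
    moreover have "b \<in> {0..<n}" "c \<in> {0..<n}" "d \<in> {0..<n}" using ab cd T(2) by blast+
    ultimately have "c = d"
      using four_residues_with_equal_pair_sums[of b n c d a] ab cd by blast
    with cd(3) show False by simp
  qed
qed

section \<open>The top row\<close>

text \<open>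
  Suppose that \<open>t\<close> is alone at the top and that \<open>s\<close> has second largest size. Two summands
  different from \<open>t\<close> are no larger than \<open>s\<close>, so their sum is smaller than \<open>t + s\<close>. Every
  representation of \<open>t + s\<close> is therefore of the form \<open>t + s'\<close>, and cancellation gives \<open>s' = s\<close>.
\<close>

lemma finite_ulam_set_two_at_top:
  assumes "0 < n" "ulam_set n U" "finite U" "2 \<le> card U"
  shows "2 \<le> card {p \<in> U. fst p = Max (fst ` U)}"
proof (rule ccontr)
  define m where "m = Max (fst ` U)"
  assume "\<not> ?thesis"
  then have single: "card {p \<in> U. fst p = m} \<le> Suc 0" by (simp add: m_def)
  have fin: "finite {p \<in> U. fst p = m}" using assms(3) by simp
  have "U \<noteq> {}" using assms(4) by auto
  then have "m \<in> fst ` U" using assms(3) by (simp add: m_def)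
  then obtain t where t: "t \<in> U" "fst t = m" by blast
  have le_m: "fst p \<le> m" if "p \<in> U" for p
    using that assms(3) by (simp add: m_def)
  have below: "fst p < m" if "p \<in> U - {t}" for p
  proof -
    have "fst p \<noteq> m"
      using that t single unfolding card_le_Suc0_iff_eq[OF fin] by blast
    with that le_m[of p] show ?thesis by simp
  qed
  have "U - {t} \<noteq> {}"
  proof
    assume "U - {t} = {}"
    then have "card U \<le> card {t}" by (intro card_mono) auto
    with assms(4) show False by simp
  qed
  then have "Max (fst ` (U - {t})) \<in> fst ` (U - {t})" using assms(3) by (intro Max_in) auto
  then obtain s where s: "s \<in> U - {t}" "fst s = Max (fst ` (U - {t}))" by force
  have le_s: "fst p \<le> fst s" if "p \<in> U - {t}" for p
    using that assms(3) by (simp add: s(2))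
  have "t \<in> U" "s \<in> U" "t \<noteq> s" "Max (fst ` U) < fst t + fst s"
    using t s ulam_set_carrier_pos(2)[OF assms(2), of s] by (auto simp: m_def)
  then obtain q r where qr: "q \<in> U" "r \<in> U" "q \<noteq> r" "{q, r} \<noteq> {t, s}"
    "q \<otimes>\<^bsub>Z_times_Zmod n\<^esub> r = t \<otimes>\<^bsub>Z_times_Zmod n\<^esub> s"
    using second_representation[OF assms(1-3), of t s] by metis
  have sums: "fst q + fst r = fst t + fst s"
    "(snd q + snd r) mod int n = (snd t + snd s) mod int n"
    using qr(5) by (simp_all add: mult_Z_times_Zmod)
  have snd: "snd p \<in> {0..<int n}" if "p \<in> U" for p
    using ulam_set_carrier_pos(1)[OF assms(2) that] assms(1)
    by (auto simp: carrier_integer_mod_group)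
  have "q = t \<or> r = t"
    using below[OF s(1)] le_s[of q] le_s[of r] sums(1) qr(1,2) t(2) by force
  then obtain s' where s': "s' \<in> U" "{q, r} = {t, s'}" "fst s' = fst s"
    "(snd t + snd s') mod int n = (snd t + snd s) mod int n"
  proof
    assume "q = t"
    then show thesis using that[of r] qr(2) sums by simp
  next
    assume "r = t"
    then show thesis using that[of q] qr(1) sums by (simp add: add.commute insert_commute)
  qed
  have "snd s' = snd s"
    using mod_add_left_cancel[OF s'(4)] snd s'(1) s(1) by blast
  with s' have "s' = s" by (simp add: prod_eq_iff)
  with s'(2) qr(4) show False by simp
qed

theorem theorem4p14:
  fixes n :: nat and U :: "(int \<times> int) set"
  assumes "0 < n"
    and "ulam_set n U"
    and "finite U"
    and "2 \<le> card U"
  shows "5 \<le> card {p \<in> U. fst p = Max (fst ` U)}"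
proof -
  define m where "m = Max (fst ` U)"
  define T where "T = {y. (m, y) \<in> U}"
  have top: "{p \<in> U. fst p = m} = Pair m ` T" by (force simp: T_def)
  have card_top: "card {p \<in> U. fst p = m} = card T"
    unfolding top by (intro card_image inj_onI) simp
  have two: "2 \<le> card T"
    using finite_ulam_set_two_at_top[OF assms] card_top by (simp add: m_def)
  have le_m: "fst p \<le> m" if "p \<in> U" for p
    using that assms(3) by (simp add: m_def)
  have "5 \<le> card T"
  proof (rule card_ge_5_if_no_unique_pair_sum)
    show "finite T" using two by (intro card_ge_0_finite) simp
    show "T \<subseteq> {0..<int n}"
      using ulam_set_carrier_pos(1)[OF assms(2)] assms(1)
      by (force simp: T_def carrier_integer_mod_group)
    show "2 \<le> card T" by (rule two)
    fix x y assume xy: "x \<in> T" "y \<in> T" "x \<noteq> y"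
    then have "(m, x) \<in> U" "(m, y) \<in> U" by (simp_all add: T_def)
    moreover have "Max (fst ` U) < fst (m, x) + fst (m, y)"
      using ulam_set_carrier_pos(2)[OF assms(2) \<open>(m, x) \<in> U\<close>] by (simp add: m_def)
    ultimately obtain q r where qr: "q \<in> U" "r \<in> U" "q \<noteq> r" "{q, r} \<noteq> {(m, x), (m, y)}"
      "q \<otimes>\<^bsub>Z_times_Zmod n\<^esub> r = (m, x) \<otimes>\<^bsub>Z_times_Zmod n\<^esub> (m, y)"
      using second_representation[OF assms(1-3), of "(m, x)" "(m, y)"] xy(3) by blast
    have sums: "fst q + fst r = m + m" "(snd q + snd r) mod int n = (x + y) mod int n"
      using qr(5) by (simp_all only: mult_Z_times_Zmod prod.inject fst_conv snd_conv)
    \<comment> \<open>Neither summand exceeds size \<open>m\<close>, so a sum of size \<open>2m\<close> comes from the top row only.\<close>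
    have "fst q = m" "fst r = m"
      using sums(1) le_m[OF qr(1)] le_m[OF qr(2)] by linarith+
    then obtain x' y' where "q = (m, x')" "r = (m, y')" by (metis prod.collapse)
    with qr sums(2) show "\<exists>x'\<in>T. \<exists>y'\<in>T. x' \<noteq> y' \<and> {x', y'} \<noteq> {x, y} \<and>
        (x' + y') mod int n = (x + y) mod int n"
      by (intro bexI[of _ x'] bexI[of _ y']) (auto simp: T_def doubleton_eq_iff)
  qed
  with card_top show ?thesis by (simp add: m_def)
qed

end
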